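(* Let $C$ be a convex body in $\mathbb{R}^d$, $d\geq 2$. Then $\widetilde I_2(C)$ is the unique number $\widetilde\rho\in(0,I(C)]$ such that $$2\widetilde\rho=\widetilde w_2(C^{\widetilde\rho}),$$ where $C^{\widetilde\rho}$ is the $\widetilde\rho$-rounded body of $C$.
   Context: A convex body in $\mathbb{R}^d$ is a compact convex set with non-empty interior. The (minimal) width $w$ of a compact set is the smallest distance between two parallel supporting hyperplanes; the inradius $I$ is the largest radius of a ball contained in the set. A $2$-division $P$ of a convex body $K$ is a decomposition of $K$ into two closed subsets $K_1,K_2$ with non-empty interior obtained by cutting $K$ with a hyperplane. For $F\in\{w,I\}$, put $\widetilde F(P)=\min\{F(K_1),F(K_2)\}$ and $\widetilde F_2(K)=\sup\{\widetilde F(P): P\text{ is a }2\text{-division of }K\}$; this defines $\widetilde w_2(K)$ and $\widetilde I_2(K)$. For $0<\rho\leq I(C)$, the $\rho$-rounded body $C^\rho$ of $C$ is the union of all balls of radius $\rho$ contained in $C$. *)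

theory Defs
  imports "HOL-Analysis.Analysis"
begin

definition convex_body :: "'a::euclidean_space set \<Rightarrow> bool" where
  "convex_body K \<longleftrightarrow> compact K \<and> convex K \<and> interior K \<noteq> {}"

text \<open>The hyperplane \<open>u \<bullet> x = c\<close> supports \<open>K\<close>, with \<open>u\<close> pointing away from \<open>K\<close>.\<close>

definition supports :: "'a::euclidean_space \<Rightarrow> real \<Rightarrow> 'a set \<Rightarrow> bool" where
  "supports u c K \<longleftrightarrow> u \<noteq> 0 \<and> (\<exists>x\<in>K. u \<bullet> x = c) \<and> (\<forall>x\<in>K. u \<bullet> x \<le> c)"

text \<open>The two parallel supporting hyperplanes are the ones with opposite outer normals
  \<open>u\<close> and \<open>- u\<close>, so that \<open>K\<close> lies between them.\<close>

definition min_width :: "'a::euclidean_space set \<Rightarrow> real" where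
  "min_width K = Inf {setdist {x. u \<bullet> x = b} {x. (- u) \<bullet> x = a} | u a b.
     supports u b K \<and> supports (- u) a K}"

definition inradius :: "'a::euclidean_space set \<Rightarrow> real" where
  "inradius K = Sup {r. 0 \<le> r \<and> (\<exists>x. cball x r \<subseteq> K)}"

definition two_division :: "'a::euclidean_space set \<Rightarrow> 'a set \<Rightarrow> 'a set \<Rightarrow> bool" where
  "two_division K K1 K2 \<longleftrightarrow>
     closed K1 \<and> closed K2 \<and> interior K1 \<noteq> {} \<and> interior K2 \<noteq> {} \<and>
     (\<exists>u c. u \<noteq> 0 \<and> K1 = K \<inter> {x. u \<bullet> x \<le> c} \<and> K2 = K \<inter> {x. u \<bullet> x \<ge> c})"

definition sup_min_division ::
    "('a::euclidean_space set \<Rightarrow> real) \<Rightarrow> 'a set \<Rightarrow> real" where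
  "sup_min_division F K = Sup {min (F K1) (F K2) | K1 K2. two_division K K1 K2}"

definition rounded_body :: "'a::euclidean_space set \<Rightarrow> real \<Rightarrow> 'a set" where
  "rounded_body C \<rho> = \<Union>{cball x \<rho> | x. cball x \<rho> \<subseteq> C}"

end

theory Submission
  imports Defs
begin

text \<open>
  Write \<open>A(\<rho>)\<close> for the set of centres of the balls of radius \<open>\<rho>\<close> contained in \<open>C\<close>, so that
  the rounded body is \<open>A(\<rho>) + \<rho>B\<close> with \<open>B\<close> the unit ball. Two balls of radius \<open>\<rho>\<close> can be
  separated by a hyperplane exactly when their centres are at distance at least \<open>2\<rho>\<close>. Hence
  the best inradius \<open>r\<close> of a 2-division of \<open>C\<close> is the largest \<open>\<rho>\<close> for which \<open>A(\<rho>)\<close> contains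
  two points at distance at least \<open>2\<rho>\<close>, and a compactness argument shows that it is attained
  (\<open>inradius_division_attained\<close>, \<open>inradius_division_greatest\<close>).

  On the side of the width, cutting between two such balls leaves pieces of width at least
  \<open>2\<rho>\<close> (\<open>width_division_ge\<close>). Conversely the two pieces of any 2-division of \<open>K\<close>, measured in
  the direction normal to the cut, have total width at most the diameter of \<open>K\<close>, so one of
  them has width at most half the diameter (\<open>width_division_le_half_diameter\<close>); for the
  rounded body that diameter is at most \<open>diam A(\<rho>) + 2\<rho>\<close>.

  At \<open>\<rho> = r\<close> this gives the equation immediately if \<open>diam A(r) \<le> 2r\<close>. If the diameter
  is larger, then \<open>A(r)\<close> has empty interior: otherwise moving two distant centres slightly
  towards an interior point of \<open>A(r)\<close> would trade their surplus distance for a larger radius,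
  against the maximality of \<open>r\<close>. So \<open>A(r)\<close> lies in a hyperplane, the rounded body in a slab of
  width \<open>2r\<close>, and again no piece is wider than \<open>2r\<close>.

  Uniqueness: for \<open>\<rho> < r\<close> the two optimal balls of radius \<open>r\<close> still lie in the
  rounded body, so its division width is at least \<open>2r > 2\<rho>\<close>; for \<open>\<rho> > r\<close> maximality
  makes \<open>diam A(\<rho>) < 2\<rho>\<close>, so its division width is less than \<open>2\<rho>\<close>.
\<close>

section \<open>Balls inside sets and half-spaces\<close>

definition ball_centres :: "'a::euclidean_space set \<Rightarrow> real \<Rightarrow> 'a set" where
  "ball_centres C r = {x. cball x r \<subseteq> C}"

text \<open>The two closed balls may touch; only their interiors are disjoint.\<close>

definition contains_disjoint_balls :: "'a::euclidean_space set \<Rightarrow> real \<Rightarrow> bool" where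
  "contains_disjoint_balls C r \<longleftrightarrow>
     (\<exists>x\<in>ball_centres C r. \<exists>y\<in>ball_centres C r. 2 * r \<le> dist x y)"

text \<open>Parametrising all balls by the same unit ball turns containment into a family of
  conditions \<open>x + r *\<^sub>R v \<in> C\<close>, each linear in the pair of centre and radius; closedness and
  convexity of \<open>C\<close> therefore pass to the set of such pairs.\<close>

lemma cball_subset_iff_unit:
  fixes x :: "'a::euclidean_space"
  assumes "0 \<le> r"
  shows "cball x r \<subseteq> C \<longleftrightarrow> (\<forall>v\<in>cball 0 1. x + r *\<^sub>R v \<in> C)"
proof (intro iffI ballI subsetI)
  fix v :: 'a assume "cball x r \<subseteq> C" "v \<in> cball 0 1"
  moreover from this have "x + r *\<^sub>R v \<in> cball x r"
    using assms mult_left_mono[of "norm v" 1 r] by (simp add: dist_norm)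
  ultimately show "x + r *\<^sub>R v \<in> C" by blast
next
  fix z assume *: "\<forall>v\<in>cball 0 1. x + r *\<^sub>R v \<in> C" and z: "z \<in> cball x r"
  show "z \<in> C"
  proof (cases "r = 0")
    case True
    then have "z = x + r *\<^sub>R 0" using z by simp
    then show ?thesis using bspec[OF *, of 0] by simp
  next
    case False
    then have "(1 / r) *\<^sub>R (z - x) \<in> cball 0 1"
      using z assms by (simp add: dist_norm norm_minus_commute)
    with * have "x + r *\<^sub>R ((1 / r) *\<^sub>R (z - x)) \<in> C" by blast
    then show ?thesis using False by simp
  qed
qed

lemma cball_inner_bounds:
  fixes u :: "'a::euclidean_space"
  assumes "u \<noteq> 0" "0 \<le> r"
  shows "\<exists>z\<in>cball x r. u \<bullet> z = u \<bullet> x + r * norm u"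
    and "\<exists>z\<in>cball x r. u \<bullet> z = u \<bullet> x - r * norm u"
    and "z \<in> cball x r \<Longrightarrow> \<bar>u \<bullet> z - u \<bullet> x\<bar> \<le> r * norm u"
proof -
  show "\<exists>z\<in>cball x r. u \<bullet> z = u \<bullet> x + r * norm u"
    using assms
    by (intro bexI[of _ "x + (r / norm u) *\<^sub>R u"])
      (auto simp: dist_norm inner_add_right power2_norm_eq_inner[symmetric] power2_eq_square)
  show "\<exists>z\<in>cball x r. u \<bullet> z = u \<bullet> x - r * norm u"
    using assms
    by (intro bexI[of _ "x - (r / norm u) *\<^sub>R u"])
      (auto simp: dist_norm inner_diff_right power2_norm_eq_inner[symmetric] power2_eq_square)
  assume "z \<in> cball x r"
  then have "norm (z - x) \<le> r" by (simp add: dist_norm norm_minus_commute)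
  then show "\<bar>u \<bullet> z - u \<bullet> x\<bar> \<le> r * norm u"
    using Cauchy_Schwarz_ineq2[of u "z - x"] mult_right_mono[of "norm (z - x)" r "norm u"]
    by (simp add: inner_diff_right mult.commute)
qed

lemma ball_centres_mono:
  assumes "C \<subseteq> D" "s \<le> r"
  shows "ball_centres C r \<subseteq> ball_centres D s"
  using assms unfolding ball_centres_def by (auto dest!: subsetD)

lemma ball_centres_subset: "0 \<le> r \<Longrightarrow> ball_centres C r \<subseteq> C"
  unfolding ball_centres_def by auto

lemma closed_centre_radius_pairs:
  fixes C :: "'a::euclidean_space set"
  assumes "closed C"
  shows "closed {(x, r). 0 \<le> r \<and> x \<in> ball_centres C r}"
proof -
  have "{(x, r). 0 \<le> r \<and> x \<in> ball_centres C r} =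
      {p. 0 \<le> snd p} \<inter> (\<Inter>v\<in>cball 0 1. (\<lambda>p. fst p + snd p *\<^sub>R v) -` C)"
    unfolding ball_centres_def using cball_subset_iff_unit[of _ _ C] by fastforce
  also have "closed \<dots>"
    using assms
    by (intro closed_Int closed_INT ballI closed_vimage closed_Collect_le continuous_intros)
  finally show ?thesis .
qed

lemma compact_ball_centres:
  fixes C :: "'a::euclidean_space set"
  assumes "compact C" "0 \<le> r"
  shows "compact (ball_centres C r)"
proof -
  have "closed ((\<lambda>x. (x, r)) -` {(x, r). 0 \<le> r \<and> x \<in> ball_centres C r})"
    using assms by (intro closed_vimage closed_centre_radius_pairs continuous_intros)
      (auto simp: compact_imp_closed)
  then have "closed (ball_centres C r)" using assms by (simp add: vimage_def)
  then have "compact (C \<inter> ball_centres C r)" using assms(1) compact_Int_closed by blast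
  then show ?thesis using ball_centres_subset[OF assms(2), of C] by (simp add: Int_absorb1)
qed

lemma ball_centres_convex_combination:
  fixes C :: "'a::euclidean_space set"
  assumes "convex C" "x \<in> ball_centres C r" "z \<in> ball_centres C s"
    and "0 \<le> r" "0 \<le> s" "0 \<le> t" "t \<le> 1"
  shows "(1 - t) *\<^sub>R x + t *\<^sub>R z \<in> ball_centres C ((1 - t) * r + t * s)"
proof -
  have nonneg: "0 \<le> (1 - t) * r + t * s" using assms by simp
  have "(1 - t) *\<^sub>R x + t *\<^sub>R z + ((1 - t) * r + t * s) *\<^sub>R v \<in> C" if "v \<in> cball 0 1" for v
  proof -
    have "x + r *\<^sub>R v \<in> C" "z + s *\<^sub>R v \<in> C"
      using assms that by (auto simp: ball_centres_def cball_subset_iff_unit)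
    then have "(1 - t) *\<^sub>R (x + r *\<^sub>R v) + t *\<^sub>R (z + s *\<^sub>R v) \<in> C"
      using assms by (intro convexD) auto
    then show ?thesis by (simp add: algebra_simps)
  qed
  then show ?thesis
    by (simp add: ball_centres_def cball_subset_iff_unit[OF nonneg])
qed

lemma convex_ball_centres:
  fixes C :: "'a::euclidean_space set"
  assumes "convex C" "0 \<le> r"
  shows "convex (ball_centres C r)"
  unfolding convex_alt
  using ball_centres_convex_combination[OF assms(1), of _ r _ r] assms(2)
  by (auto simp: algebra_simps)

text \<open>If the ball of radius \<open>e\<close> around \<open>z\<close> consists of centres, then every point within \<open>r + e\<close>
  of \<open>z\<close> is within \<open>r\<close> of one of them.\<close>

lemma interior_ball_centres_larger_radius:
  fixes C :: "'a::euclidean_space set"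
  assumes "z \<in> interior (ball_centres C r)" "0 \<le> r"
  obtains s where "r < s" "z \<in> ball_centres C s"
proof -
  obtain e where e: "0 < e" "cball z e \<subseteq> ball_centres C r"
    using assms(1) mem_interior_cball by blast
  have "z + (r + e) *\<^sub>R v \<in> C" if v: "v \<in> cball 0 1" for v
  proof -
    have "z + e *\<^sub>R v \<in> ball_centres C r"
      using e v by (auto simp: dist_norm intro!: subsetD[OF e(2)])
    then have "(z + e *\<^sub>R v) + r *\<^sub>R v \<in> C"
      using v assms(2) by (auto simp: ball_centres_def cball_subset_iff_unit)
    then show ?thesis by (simp add: algebra_simps)
  qed
  then have "z \<in> ball_centres C (r + e)"
    using e assms(2) by (simp add: ball_centres_def cball_subset_iff_unit)
  then show thesis using that[of "r + e"] e by simp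
qed

lemma cball_contains_disjoint_balls:
  fixes x :: "'a::euclidean_space"
  assumes "0 < r" "cball x r \<subseteq> C"
  shows "contains_disjoint_balls C (r / 3)"
proof -
  obtain b :: 'a where b: "norm b = 1" by (metis vector_choose_size zero_le_one)
  let ?y = "x + (2 * r / 3) *\<^sub>R b"
  have "dist x ?y = 2 * r / 3" using b assms by (simp add: dist_norm)
  moreover from this have "cball ?y (r / 3) \<subseteq> cball x r"
    by (simp add: subset_cball cball_subset_cball_iff dist_commute)
  moreover have "cball x (r / 3) \<subseteq> cball x r" using assms by auto
  ultimately show ?thesis
    using assms unfolding contains_disjoint_balls_def ball_centres_def
    by (intro bexI[of _ x] bexI[of _ ?y]) (blast | simp)+
qed

section \<open>Inradius and minimal width\<close>

lemma radius_le_diameter: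
  fixes K :: "'a::euclidean_space set"
  assumes "compact K" "0 \<le> r" "x \<in> ball_centres K r"
  shows "r \<le> diameter K"
proof -
  obtain b :: 'a where b: "norm b = 1" by (metis vector_choose_size zero_le_one)
  have "x \<in> K" "x + r *\<^sub>R b \<in> K"
    using assms b by (auto simp: ball_centres_def dist_norm intro!: subsetD[of "cball x r" K])
  then have "dist x (x + r *\<^sub>R b) \<le> diameter K"
    using assms(1) diameter_bounded_bound compact_imp_bounded by blast
  then show ?thesis using b assms by (simp add: dist_norm)
qed

lemma inradius_ge:
  fixes K :: "'a::euclidean_space set"
  assumes "compact K" "0 \<le> r" "x \<in> ball_centres K r"
  shows "r \<le> inradius K"
  unfolding inradius_def
proof (rule cSup_upper)
  show "r \<in> {r. 0 \<le> r \<and> (\<exists>x. cball x r \<subseteq> K)}" using assms by (auto simp: ball_centres_def)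
  show "bdd_above {r. 0 \<le> r \<and> (\<exists>x. cball x r \<subseteq> K)}"
    using radius_le_diameter[OF assms(1)]
    by (auto simp: ball_centres_def intro!: bdd_aboveI[of _ "diameter K"])
qed

lemma inradius_attained:
  fixes K :: "'a::euclidean_space set"
  assumes "compact K" "K \<noteq> {}"
  obtains x where "0 \<le> inradius K" "x \<in> ball_centres K (inradius K)"
proof -
  let ?P = "{(x, r). 0 \<le> r \<and> x \<in> ball_centres K r}"
  have "?P \<subseteq> K \<times> {0..diameter K}"
    using radius_le_diameter[OF assms(1)] ball_centres_subset[of _ K] by auto
  then have "(K \<times> {0..diameter K}) \<inter> ?P = ?P" by (rule Int_absorb1)
  then have "compact ?P"
    using compact_Int_closed[OF compact_Times[OF assms(1) compact_Icc]
        closed_centre_radius_pairs[OF compact_imp_closed[OF assms(1)]], of 0 "diameter K"]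
    by (simp only:)
  then have "compact (snd ` ?P)" by (intro compact_continuous_image continuous_intros)
  moreover have "snd ` ?P \<noteq> {}"
  proof -
    obtain x where "x \<in> K" using assms(2) by blast
    then have "(x, 0) \<in> ?P" by (simp add: ball_centres_def)
    then show ?thesis by blast
  qed
  ultimately obtain m where m: "m \<in> snd ` ?P" "\<forall>r\<in>snd ` ?P. r \<le> m"
    using compact_attains_sup by blast
  then obtain x where x: "0 \<le> m" "x \<in> ball_centres K m" by auto
  have "inradius K = m"
    unfolding inradius_def
  proof (rule cSup_eq_maximum)
    show "m \<in> {r. 0 \<le> r \<and> (\<exists>x. cball x r \<subseteq> K)}" using x by (auto simp: ball_centres_def)
    fix r assume "r \<in> {r. 0 \<le> r \<and> (\<exists>x. cball x r \<subseteq> K)}"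
    then obtain y where "(y, r) \<in> ?P" by (auto simp: ball_centres_def)
    then have "snd (y, r) \<in> snd ` ?P" by (rule imageI)
    then show "r \<le> m" using bspec[OF m(2), of "snd (y, r)"] by simp
  qed
  then show thesis using that x by simp
qed

lemma inradius_mono:
  fixes K :: "'a::euclidean_space set"
  assumes "compact K" "K \<noteq> {}" "K \<subseteq> L" "compact L"
  shows "inradius K \<le> inradius L"
proof -
  obtain x where x: "0 \<le> inradius K" "x \<in> ball_centres K (inradius K)"
    using inradius_attained[OF assms(1,2)] .
  then have "x \<in> ball_centres L (inradius K)"
    using ball_centres_mono[OF assms(3) order_refl] by blast
  then show ?thesis using inradius_ge[OF assms(4) x(1)] by simp
qed

lemma supports_exists:
  fixes K :: "'a::euclidean_space set"
  assumes "compact K" "K \<noteq> {}" "u \<noteq> 0"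
  obtains b where "supports u b K"
proof -
  have "continuous_on K (\<lambda>x. u \<bullet> x)" by (intro continuous_intros)
  then obtain x where "x \<in> K" "\<forall>y\<in>K. u \<bullet> y \<le> u \<bullet> x"
    using continuous_attains_sup[OF assms(1,2)] by blast
  then have "supports u (u \<bullet> x) K" using assms by (auto simp: supports_def)
  then show thesis using that by blast
qed

lemma min_width_le:
  fixes K :: "'a::euclidean_space set"
  assumes "compact K" "K \<noteq> {}" "u \<noteq> 0" "\<And>x. x \<in> K \<Longrightarrow> c \<le> u \<bullet> x \<and> u \<bullet> x \<le> d"
  shows "min_width K \<le> (d - c) / norm u"
proof -
  obtain b where b: "supports u b K" using supports_exists assms by blast
  obtain a where a: "supports (- u) a K" using supports_exists[of K "- u"] assms by auto
  obtain x where x: "x \<in> K" "u \<bullet> x = b" using b by (auto simp: supports_def)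
  have bd: "b \<le> d" using x assms(4) by auto
  have ac: "a \<le> - c" using a assms(4) by (force simp: supports_def)
  have "- (u \<bullet> x) \<le> a" using a x by (auto simp: supports_def)
  then have ab: "0 \<le> a + b" using x by simp
  let ?y = "x - ((a + b) / (norm u)\<^sup>2) *\<^sub>R u"
  have nz: "norm u \<noteq> 0" using assms by simp
  have y: "(- u) \<bullet> ?y = a"
    using x assms(3) by (simp add: inner_diff_right power2_norm_eq_inner)
  have "min_width K \<le> setdist {x. u \<bullet> x = b} {x. (- u) \<bullet> x = a}"
    unfolding min_width_def
    using a b by (intro cInf_lower bdd_belowI[of _ 0]) (auto simp: setdist_pos_le)
  also have "\<dots> \<le> dist x ?y" using x y by (intro setdist_le_dist) auto
  also have "\<dots> = (a + b) / norm u"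
    using ab nz by (simp add: dist_norm power2_eq_square)
  also have "\<dots> \<le> (d - c) / norm u"
    using bd ac by (intro divide_right_mono) auto
  finally show ?thesis .
qed

lemma min_width_ge:
  fixes K :: "'a::euclidean_space set"
  assumes "compact K" "0 \<le> r" "x \<in> ball_centres K r"
  shows "2 * r \<le> min_width K"
  unfolding min_width_def
proof (rule cInf_greatest)
  have ne: "K \<noteq> {}" using assms ball_centres_subset by blast
  obtain u :: 'a where u: "norm u = 1" by (metis vector_choose_size zero_le_one)
  then have "u \<noteq> 0" "- u \<noteq> 0" by auto
  then obtain a b where "supports u b K" "supports (- u) a K"
    using supports_exists[OF assms(1) ne] by metis
  then show "{setdist {x. u \<bullet> x = b} {x. (- u) \<bullet> x = a} | u a b.
      supports u b K \<and> supports (- u) a K} \<noteq> {}" by blast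
next
  fix w
  assume "w \<in> {setdist {x. u \<bullet> x = b} {x. (- u) \<bullet> x = a} | u a b.
      supports u b K \<and> supports (- u) a K}"
  then obtain u a b where w: "w = setdist {x. u \<bullet> x = b} {x. (- u) \<bullet> x = a}"
    and b: "supports u b K" and a: "supports (- u) a K" by blast
  have u: "u \<noteq> 0" using b by (simp add: supports_def)
  have K: "cball x r \<subseteq> K" using assms by (simp add: ball_centres_def)
  have "u \<bullet> x + r * norm u \<le> b"
    using cball_inner_bounds(1)[OF u assms(2), of x] K b unfolding supports_def by fastforce
  moreover have "- (u \<bullet> x - r * norm u) \<le> a"
    using cball_inner_bounds(2)[OF u assms(2), of x] K a unfolding supports_def by fastforce
  ultimately have ab: "2 * r * norm u \<le> a + b" by simp
  show "2 * r \<le> w"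
    unfolding w
  proof (rule le_setdistI)
    show "{x. u \<bullet> x = b} \<noteq> {}" "{x. (- u) \<bullet> x = a} \<noteq> {}"
      using a b by (auto simp: supports_def)
    fix p q assume "p \<in> {x. u \<bullet> x = b}" "q \<in> {x. (- u) \<bullet> x = a}"
    then have "u \<bullet> (p - q) = a + b" by (simp add: inner_diff_right)
    then have "2 * r * norm u \<le> dist p q * norm u"
      using ab norm_cauchy_schwarz[of u "p - q"] by (simp add: dist_norm mult.commute)
    then show "2 * r \<le> dist p q" using u by simp
  qed
qed

section \<open>Two-divisions\<close>

lemma two_division_compact:
  fixes K :: "'a::euclidean_space set"
  assumes "two_division K K1 K2" "compact K"
  shows "compact K1" "compact K2" "K1 \<noteq> {}" "K2 \<noteq> {}" "K1 \<subseteq> K" "K2 \<subseteq> K"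
proof -
  show "K1 \<subseteq> K" "K2 \<subseteq> K" "K1 \<noteq> {}" "K2 \<noteq> {}"
    using assms by (auto simp: two_division_def)
  then show "compact K1" "compact K2"
    using assms compact_Int_closed[OF assms(2), of K1] compact_Int_closed[OF assms(2), of K2]
    by (auto simp: two_division_def Int_absorb1)
qed

lemma two_division_between_balls:
  fixes K :: "'a::euclidean_space set"
  assumes "compact K" "0 < r" "contains_disjoint_balls K r"
  obtains K1 K2 x y where "two_division K K1 K2"
    "x \<in> ball_centres K1 r" "y \<in> ball_centres K2 r"
proof -
  obtain x y where x: "cball x r \<subseteq> K" and y: "cball y r \<subseteq> K" and d: "2 * r \<le> dist x y"
    using assms(3) by (auto simp: contains_disjoint_balls_def ball_centres_def)
  \<comment> \<open>The cut is the perpendicular bisector of the two centres.\<close>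
  define u where "u = y - x"
  define c where "c = u \<bullet> x + (norm u)\<^sup>2 / 2"
  have u: "u \<noteq> 0" using d assms by (auto simp: u_def)
  have cy: "c = u \<bullet> y - (norm u)\<^sup>2 / 2"
    by (simp add: c_def u_def power2_norm_eq_inner algebra_simps)
  have "2 * r \<le> norm u" using d by (simp add: u_def dist_norm norm_minus_commute)
  then have *: "r * norm u \<le> (norm u)\<^sup>2 / 2"
    using mult_right_mono[of "2 * r" "norm u" "norm u"] by (simp add: power2_eq_square)
  define K1 where "K1 = K \<inter> {x. u \<bullet> x \<le> c}"
  define K2 where "K2 = K \<inter> {x. u \<bullet> x \<ge> c}"
  have r0: "0 \<le> r" using assms by simp
  have x1: "cball x r \<subseteq> K1"
    using x * cball_inner_bounds(3)[OF u r0, of _ x]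
    by (fastforce simp: K1_def c_def)
  have y2: "cball y r \<subseteq> K2"
    using y * cball_inner_bounds(3)[OF u r0, of _ y]
    by (fastforce simp: K2_def cy)
  have "closed K1" "closed K2"
    using compact_imp_closed[OF assms(1)] unfolding K1_def K2_def
    by (auto intro!: closed_Int closed_halfspace_le closed_halfspace_ge)
  moreover have "interior K1 \<noteq> {}" "interior K2 \<noteq> {}"
    using x1 y2 assms(2) mem_interior_cball by blast+
  ultimately have "two_division K K1 K2"
    using u unfolding two_division_def K1_def K2_def by blast
  then show thesis using that x1 y2 by (auto simp: ball_centres_def)
qed

lemma contains_disjoint_balls_if_two_division:
  fixes K :: "'a::euclidean_space set"
  assumes "two_division K K1 K2" "0 \<le> r" "x \<in> ball_centres K1 r" "y \<in> ball_centres K2 r"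
  shows "contains_disjoint_balls K r"
proof -
  obtain u c where u: "u \<noteq> 0" and K: "K1 = K \<inter> {x. u \<bullet> x \<le> c}" "K2 = K \<inter> {x. u \<bullet> x \<ge> c}"
    using assms(1) by (auto simp: two_division_def)
  have "u \<bullet> x + r * norm u \<le> c"
    using cball_inner_bounds(1)[OF u assms(2), of x] assms(3) K
    unfolding ball_centres_def by fastforce
  moreover have "c \<le> u \<bullet> y - r * norm u"
    using cball_inner_bounds(2)[OF u assms(2), of y] assms(4) K
    unfolding ball_centres_def by fastforce
  ultimately have "2 * r * norm u \<le> u \<bullet> (y - x)" by (simp add: inner_diff_right)
  also have "\<dots> \<le> dist x y * norm u"
    using norm_cauchy_schwarz[of u "y - x"] by (simp add: dist_norm norm_minus_commute mult.commute)
  finally have "2 * r \<le> dist x y" using u by simp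
  then show ?thesis
    using assms K by (auto simp: contains_disjoint_balls_def ball_centres_def)
qed

text \<open>Measured along the normal of the cut, the widths of the two pieces add up to the width of
  the whole set, which the diameter bounds.\<close>

lemma two_division_width_le:
  fixes K :: "'a::euclidean_space set"
  assumes "two_division K K1 K2" "compact K" "\<And>x y. x \<in> K \<Longrightarrow> y \<in> K \<Longrightarrow> dist x y \<le> D"
  shows "min (min_width K1) (min_width K2) \<le> D / 2"
proof -
  note cpt = two_division_compact[OF assms(1,2)]
  obtain u c where u: "u \<noteq> 0" and K: "K1 = K \<inter> {x. u \<bullet> x \<le> c}" "K2 = K \<inter> {x. u \<bullet> x \<ge> c}"
    using assms(1) by (auto simp: two_division_def)
  have ne: "K \<noteq> {}" using cpt by blast
  have cont: "continuous_on K (\<lambda>x. u \<bullet> x)" by (intro continuous_intros)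
  obtain p where p: "p \<in> K" "\<forall>x\<in>K. u \<bullet> x \<le> u \<bullet> p"
    using continuous_attains_sup[OF assms(2) ne cont] by blast
  obtain q where q: "q \<in> K" "\<forall>x\<in>K. u \<bullet> q \<le> u \<bullet> x"
    using continuous_attains_inf[OF assms(2) ne cont] by blast
  have "min_width K1 \<le> (c - u \<bullet> q) / norm u"
    using cpt u q K by (intro min_width_le) auto
  moreover have "min_width K2 \<le> (u \<bullet> p - c) / norm u"
    using cpt u p K by (intro min_width_le) auto
  ultimately have "min_width K1 + min_width K2 \<le> (c - u \<bullet> q) / norm u + (u \<bullet> p - c) / norm u"
    by simp
  also have "\<dots> = u \<bullet> (p - q) / norm u"
    by (simp add: inner_diff_right add_divide_distrib diff_divide_distrib)
  also have "\<dots> \<le> dist p q"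
    using norm_cauchy_schwarz[of u "p - q"] u
    by (simp add: dist_norm divide_le_eq mult.commute)
  also have "\<dots> \<le> D" using assms(3) p q by simp
  finally show ?thesis by simp
qed

lemma width_division_ge:
  fixes K :: "'a::euclidean_space set"
  assumes "compact K" "0 < r" "contains_disjoint_balls K r"
  shows "2 * r \<le> sup_min_division min_width K"
proof -
  obtain K1 K2 x y where division: "two_division K K1 K2"
    and xy: "x \<in> ball_centres K1 r" "y \<in> ball_centres K2 r"
    using two_division_between_balls[OF assms] .
  note cpt = two_division_compact[OF division assms(1)]
  have "dist x y \<le> diameter K" if "x \<in> K" "y \<in> K" for x y
    using that assms(1) diameter_bounded_bound compact_imp_bounded by blast
  then have "bdd_above {min (min_width K1) (min_width K2) | K1 K2. two_division K K1 K2}"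
    using two_division_width_le[OF _ assms(1), where D = "diameter K"]
    by (intro bdd_aboveI[of _ "diameter K / 2"]) blast
  then have "min (min_width K1) (min_width K2) \<le> sup_min_division min_width K"
    unfolding sup_min_division_def using division by (intro cSup_upper) auto
  moreover have "2 * r \<le> min (min_width K1) (min_width K2)"
    using min_width_ge[OF cpt(1) _ xy(1)] min_width_ge[OF cpt(2) _ xy(2)] assms(2) by simp
  ultimately show ?thesis by linarith
qed

lemma sup_min_division_le:
  fixes K :: "'a::euclidean_space set"
  assumes "compact K" "0 < r" "contains_disjoint_balls K r"
    and "\<And>K1 K2. two_division K K1 K2 \<Longrightarrow> min (F K1) (F K2) \<le> b"
  shows "sup_min_division F K \<le> b"
  unfolding sup_min_division_def
proof (rule cSup_least)
  obtain K1 K2 x y where "two_division K K1 K2"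
    "x \<in> ball_centres K1 r" "y \<in> ball_centres K2 r"
    using two_division_between_balls[OF assms(1-3)] .
  then show "{min (F K1) (F K2) | K1 K2. two_division K K1 K2} \<noteq> {}" by blast
next
  fix w assume "w \<in> {min (F K1) (F K2) | K1 K2. two_division K K1 K2}"
  then show "w \<le> b" using assms(4) by auto
qed

lemma width_division_le_half_diameter:
  fixes K :: "'a::euclidean_space set"
  assumes "compact K" "0 < r" "contains_disjoint_balls K r"
    and "\<And>x y. x \<in> K \<Longrightarrow> y \<in> K \<Longrightarrow> dist x y \<le> D"
  shows "sup_min_division min_width K \<le> D / 2"
proof (rule sup_min_division_le[OF assms(1-3)])
  show "min (min_width K1) (min_width K2) \<le> D / 2" if "two_division K K1 K2" for K1 K2
    using two_division_width_le[OF that assms(1,4)] .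
qed

section \<open>The best inradius of a two-division\<close>

lemma inradius_division_greatest:
  fixes C :: "'a::euclidean_space set"
  assumes "compact C" "0 < r" "contains_disjoint_balls C r"
  shows "r \<le> sup_min_division inradius C"
proof -
  obtain K1 K2 x y where division: "two_division C K1 K2"
    and xy: "x \<in> ball_centres K1 r" "y \<in> ball_centres K2 r"
    using two_division_between_balls[OF assms] .
  note cpt = two_division_compact[OF division assms(1)]
  have "min (inradius L1) (inradius L2) \<le> inradius C" if "two_division C L1 L2" for L1 L2
  proof -
    note piece = two_division_compact[OF that assms(1)]
    show ?thesis using inradius_mono[OF piece(1,3,5) assms(1)] by simp
  qed
  then have "bdd_above {min (inradius K1) (inradius K2) | K1 K2. two_division C K1 K2}"
    by (intro bdd_aboveI[of _ "inradius C"]) blast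
  then have "min (inradius K1) (inradius K2) \<le> sup_min_division inradius C"
    unfolding sup_min_division_def using division by (intro cSup_upper) auto
  moreover have "r \<le> min (inradius K1) (inradius K2)"
    using inradius_ge[OF cpt(1) _ xy(1)] inradius_ge[OF cpt(2) _ xy(2)] assms(2) by simp
  ultimately show ?thesis by linarith
qed

text \<open>The admissible triples of two centres and a common radius form a compact set, so there is
  a largest admissible radius; the supremum over the 2-divisions cannot exceed it, because
  inscribed balls of the two pieces, shrunk to equal radius, form an admissible triple.\<close>

lemma inradius_division_attained:
  fixes C :: "'a::euclidean_space set"
  assumes "compact C" "interior C \<noteq> {}"
  shows "0 < sup_min_division inradius C"
    and "contains_disjoint_balls C (sup_min_division inradius C)"
proof -
  let ?R = "{r. 0 \<le> r \<and> contains_disjoint_balls C r}"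
  let ?P = "{(x, r). 0 \<le> r \<and> x \<in> ball_centres C r}"
  let ?T = "{p. (fst p, snd (snd p)) \<in> ?P} \<inter> {p. (fst (snd p), snd (snd p)) \<in> ?P}
    \<inter> {p. 2 * snd (snd p) \<le> dist (fst p) (fst (snd p))}"
  have P: "closed ?P" using assms(1) closed_centre_radius_pairs compact_imp_closed by blast
  have "closed ((\<lambda>p::'a \<times> 'a \<times> real. (fst p, snd (snd p))) -` ?P)"
    "closed ((\<lambda>p::'a \<times> 'a \<times> real. (fst (snd p), snd (snd p))) -` ?P)"
    using P by (intro closed_vimage continuous_intros; assumption)+
  moreover have "closed {p::'a \<times> 'a \<times> real. 2 * snd (snd p) \<le> dist (fst p) (fst (snd p))}"
    by (intro closed_Collect_le continuous_intros)
  ultimately have "closed ?T"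
    unfolding vimage_def by (intro closed_Int)
  moreover have "?T \<subseteq> C \<times> C \<times> {0..diameter C}"
    using radius_le_diameter[OF assms(1)] subsetD[OF ball_centres_subset[of _ C]] by auto
  then have "(C \<times> C \<times> {0..diameter C}) \<inter> ?T = ?T" by (rule Int_absorb1)
  ultimately have "compact ?T"
    using compact_Int_closed[OF compact_Times[OF assms(1) compact_Times[OF assms(1) compact_Icc]],
        of ?T 0 "diameter C"]
    by (simp only:)
  then have "compact ((\<lambda>p. snd (snd p)) ` ?T)"
    by (intro compact_continuous_image continuous_intros)
  moreover have "(\<lambda>p. snd (snd p)) ` ?T = ?R"
  proof (intro equalityI subsetI)
    fix r assume "r \<in> ?R"
    then obtain x y where "(x, y, r) \<in> ?T" by (auto simp: contains_disjoint_balls_def)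
    then show "r \<in> (\<lambda>p. snd (snd p)) ` ?T" by (rule rev_image_eqI) simp
  next
    fix r assume "r \<in> (\<lambda>p. snd (snd p)) ` ?T"
    then obtain x y where "(x, y, r) \<in> ?T" by auto
    then show "r \<in> ?R" unfolding contains_disjoint_balls_def by auto
  qed
  ultimately have R: "compact ?R" by simp
  obtain x e where e: "0 < e" "cball x e \<subseteq> C"
    using assms(2) mem_interior_cball by blast
  then have pos: "e / 3 \<in> ?R" "0 < e / 3" using cball_contains_disjoint_balls by auto
  then obtain m where m: "m \<in> ?R" "\<forall>r\<in>?R. r \<le> m"
    using compact_attains_sup[OF R] by blast
  have m0: "0 < m" using pos(2) bspec[OF m(2) pos(1)] by linarith
  have "sup_min_division inradius C \<le> m"
  proof (rule sup_min_division_le[OF assms(1) m0])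
    show "contains_disjoint_balls C m" using m by simp
    fix K1 K2 assume division: "two_division C K1 K2"
    note cpt = two_division_compact[OF division assms(1)]
    obtain x where x: "0 \<le> inradius K1" "x \<in> ball_centres K1 (inradius K1)"
      using inradius_attained cpt by metis
    obtain y where y: "0 \<le> inradius K2" "y \<in> ball_centres K2 (inradius K2)"
      using inradius_attained cpt by metis
    let ?r = "min (inradius K1) (inradius K2)"
    have "x \<in> ball_centres K1 ?r" "y \<in> ball_centres K2 ?r"
      using x(2) y(2) subsetD[OF ball_centres_mono[OF order_refl min.cobounded1]]
        subsetD[OF ball_centres_mono[OF order_refl min.cobounded2]] by blast+
    then have "contains_disjoint_balls C ?r"
      using contains_disjoint_balls_if_two_division[OF division] x y by simp
    then show "?r \<le> m" using m x y by simp
  qed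
  moreover have "m \<le> sup_min_division inradius C"
    using inradius_division_greatest assms(1) m m0 by blast
  ultimately have "sup_min_division inradius C = m" by simp
  then show "0 < sup_min_division inradius C"
    "contains_disjoint_balls C (sup_min_division inradius C)"
    using m m0 by auto
qed

text \<open>If two optimal centres are further apart than necessary, the centres cannot surround an
  interior point: pulling both centres towards it would allow a larger common radius.\<close>

lemma interior_optimal_centres_empty:
  fixes C :: "'a::euclidean_space set"
  assumes "convex C" "0 \<le> r" "x \<in> ball_centres C r" "y \<in> ball_centres C r" "2 * r < dist x y"
    and optimal: "\<And>s. r < s \<Longrightarrow> \<not> contains_disjoint_balls C s"
  shows "interior (ball_centres C r) = {}"
proof (rule ccontr)
  assume "interior (ball_centres C r) \<noteq> {}"
  then obtain z where "z \<in> interior (ball_centres C r)" by blast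
  then obtain s where s: "r < s" "z \<in> ball_centres C s"
    using interior_ball_centres_larger_radius assms(2) by blast
  \<comment> \<open>This \<open>t\<close> solves \<open>(1 - t) d = 2 ((1 - t) r + t s)\<close>: the contracted centres are exactly one
    new diameter apart.\<close>
  define d where "d = dist x y"
  define t where "t = (d - 2 * r) / (d - 2 * r + 2 * s)"
  have t: "0 < t" "t \<le> 1" using assms s by (auto simp: t_def d_def divide_simps)
  have "t * (d - 2 * r + 2 * s) = d - 2 * r" using assms s by (simp add: t_def d_def)
  then have eq: "(1 - t) * d = 2 * ((1 - t) * r + t * s)" by (simp add: algebra_simps)
  let ?r = "(1 - t) * r + t * s"
  have "(1 - t) *\<^sub>R x + t *\<^sub>R z \<in> ball_centres C ?r" "(1 - t) *\<^sub>R y + t *\<^sub>R z \<in> ball_centres C ?r"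
    using assms s t by (auto intro!: ball_centres_convex_combination)
  moreover have "dist ((1 - t) *\<^sub>R x + t *\<^sub>R z) ((1 - t) *\<^sub>R y + t *\<^sub>R z) = (1 - t) * d"
    using t by (simp add: d_def dist_norm scaleR_diff_right[symmetric])
  ultimately have "contains_disjoint_balls C ?r"
    using eq unfolding contains_disjoint_balls_def by (metis order_refl)
  moreover have "r < ?r"
    using t s mult_strict_left_mono[of r s t] by (simp add: algebra_simps)
  ultimately show False using optimal by blast
qed

section \<open>Rounded bodies\<close>

lemma rounded_body_eq: "rounded_body C r = (\<Union>x\<in>ball_centres C r. cball x r)"
  by (auto simp: rounded_body_def ball_centres_def)

lemma compact_rounded_body:
  fixes C :: "'a::euclidean_space set"
  assumes "compact C" "0 \<le> r"
  shows "compact (rounded_body C r)"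
proof -
  have "rounded_body C r = {x + y | x y. x \<in> ball_centres C r \<and> y \<in> cball 0 r}"
  proof (intro equalityI subsetI)
    fix z assume "z \<in> rounded_body C r"
    then obtain x where "x \<in> ball_centres C r" "z \<in> cball x r" by (auto simp: rounded_body_eq)
    then show "z \<in> {x + y | x y. x \<in> ball_centres C r \<and> y \<in> cball 0 r}"
      by (intro CollectI exI[of _ x] exI[of _ "z - x"]) (auto simp: dist_norm norm_minus_commute)
  next
    fix z assume "z \<in> {x + y | x y. x \<in> ball_centres C r \<and> y \<in> cball 0 r}"
    then obtain x y where "x \<in> ball_centres C r" "y \<in> cball 0 r" "z = x + y" by blast
    then show "z \<in> rounded_body C r"
      unfolding rounded_body_eq by (intro UN_I[of x]) (auto simp: dist_norm)
  qed
  then show ?thesis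
    using compact_sums[OF compact_ball_centres[OF assms] compact_cball] by (simp only:)
qed

text \<open>Rounding with radius \<open>s\<close> keeps every ball of radius at least \<open>s\<close>, since such a ball is the
  union of the balls of radius \<open>s\<close> inside it.\<close>

lemma ball_centres_rounded_body:
  fixes C :: "'a::euclidean_space set"
  assumes "0 \<le> s" "s \<le> r"
  shows "ball_centres C r \<subseteq> ball_centres (rounded_body C s) r"
proof
  fix x assume x: "x \<in> ball_centres C r"
  have "z \<in> rounded_body C s" if z: "z \<in> cball x r" for z
  proof (cases "r = 0")
    case True
    then show ?thesis using x z assms by (auto simp: rounded_body_eq)
  next
    case False
    then have r: "0 < r" using assms by simp
    define v where "v = (1 / r) *\<^sub>R (z - x)"
    have v: "norm v \<le> 1" "z = x + r *\<^sub>R v"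
      using z r by (auto simp: v_def dist_norm norm_minus_commute divide_simps)
    let ?y = "x + (r - s) *\<^sub>R v"
    have "dist ?y x \<le> r - s"
      using v assms mult_left_mono[of "norm v" 1 "r - s"] by (simp add: dist_norm)
    then have "cball ?y s \<subseteq> cball x r" by (simp add: cball_subset_cball_iff)
    then have "?y \<in> ball_centres C s" using x by (auto simp: ball_centres_def)
    moreover have "dist ?y z \<le> s"
    proof -
      have "?y - z = - (s *\<^sub>R v)" using v(2) by (simp add: algebra_simps)
      then show ?thesis using v(1) assms mult_left_mono[of "norm v" 1 s] by (simp add: dist_norm)
    qed
    ultimately show ?thesis by (auto simp: rounded_body_eq)
  qed
  then show "x \<in> ball_centres (rounded_body C s) r" by (auto simp: ball_centres_def)
qed

lemma contains_disjoint_balls_rounded_body: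
  fixes C :: "'a::euclidean_space set"
  assumes "0 \<le> s" "s \<le> r" "contains_disjoint_balls C r"
  shows "contains_disjoint_balls (rounded_body C s) r"
  using ball_centres_rounded_body[OF assms(1,2), of C] assms(3)
  unfolding contains_disjoint_balls_def by blast

lemma dist_rounded_body_le:
  fixes C :: "'a::euclidean_space set"
  assumes "\<And>x y. x \<in> ball_centres C r \<Longrightarrow> y \<in> ball_centres C r \<Longrightarrow> dist x y \<le> D"
    and "p \<in> rounded_body C r" "q \<in> rounded_body C r"
  shows "dist p q \<le> D + 2 * r"
proof -
  obtain x y where xy: "x \<in> ball_centres C r" "y \<in> ball_centres C r" "dist x p \<le> r" "dist y q \<le> r"
    using assms(2,3) by (auto simp: rounded_body_eq)
  have "dist p q \<le> dist x p + dist x y + dist y q"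
    using dist_triangle[of p q x] dist_triangle[of x q y] by (simp add: dist_commute)
  then show ?thesis using xy assms(1)[of x y] by simp
qed

text \<open>Any two centres are less than \<open>2r\<close> apart, and by compactness so are the two furthest
  ones; hence the bound by half the diameter is strict even for the supremum over all
  divisions.\<close>

lemma width_division_rounded_body_less:
  fixes C :: "'a::euclidean_space set"
  assumes "compact C" "0 < r" "r \<le> inradius C" "C \<noteq> {}" "\<not> contains_disjoint_balls C r"
  shows "sup_min_division min_width (rounded_body C r) < 2 * r"
proof -
  have r0: "0 \<le> r" using assms by simp
  obtain x where "x \<in> ball_centres C (inradius C)"
    using inradius_attained[OF assms(1,4)] by blast
  then have x: "x \<in> ball_centres C r" using ball_centres_mono[OF order_refl assms(3)] by blast
  let ?A = "ball_centres C r"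
  have cpt: "compact ?A" using compact_ball_centres assms(1) r0 by blast
  obtain p q where pq: "p \<in> ?A" "q \<in> ?A" "dist p q = diameter ?A"
    using diameter_compact_attained[OF cpt] x by blast
  then have less: "diameter ?A < 2 * r"
    using assms(5) unfolding contains_disjoint_balls_def by force
  have "dist y z \<le> diameter ?A" if "y \<in> ?A" "z \<in> ?A" for y z
    using that cpt diameter_bounded_bound compact_imp_bounded by blast
  then have "dist y z \<le> diameter ?A + 2 * r"
    if "y \<in> rounded_body C r" "z \<in> rounded_body C r" for y z
    using dist_rounded_body_le that by blast
  moreover have "contains_disjoint_balls (rounded_body C r) (r / 3)"
    using x assms(2) by (intro cball_contains_disjoint_balls) (auto simp: rounded_body_eq)
  ultimately have "sup_min_division min_width (rounded_body C r) \<le> (diameter ?A + 2 * r) / 2"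
    using assms(2) compact_rounded_body[OF assms(1) r0]
    by (intro width_division_le_half_diameter[of _ "r / 3"]) auto
  then show ?thesis using less by simp
qed

lemma width_division_rounded_body_optimal:
  fixes C :: "'a::euclidean_space set"
  assumes "compact C" "convex C" "0 < r" "contains_disjoint_balls C r"
    and optimal: "\<And>s. r < s \<Longrightarrow> \<not> contains_disjoint_balls C s"
  shows "sup_min_division min_width (rounded_body C r) = 2 * r"
proof (rule antisym)
  let ?A = "ball_centres C r" and ?K = "rounded_body C r"
  have r0: "0 \<le> r" using assms by simp
  have cpt: "compact ?K" using compact_rounded_body assms(1) r0 by blast
  have balls: "contains_disjoint_balls ?K r"
    using contains_disjoint_balls_rounded_body assms(4) r0 by blast
  show "2 * r \<le> sup_min_division min_width ?K" using width_division_ge cpt assms(3) balls .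
  show "sup_min_division min_width ?K \<le> 2 * r"
  proof (cases "\<forall>x\<in>?A. \<forall>y\<in>?A. dist x y \<le> 2 * r")
    case True
    then have "dist p q \<le> 2 * r + 2 * r" if "p \<in> ?K" "q \<in> ?K" for p q
      using dist_rounded_body_le that by blast
    then show ?thesis
      using width_division_le_half_diameter[OF cpt assms(3) balls, of "2 * r + 2 * r"] by simp
  next
    case False
    then obtain x y where "x \<in> ?A" "y \<in> ?A" "2 * r < dist x y"
      by (meson not_le)
    then have "interior ?A = {}"
      using interior_optimal_centres_empty[OF assms(2) r0 _ _ _ optimal] by simp
    then obtain u b where u: "u \<noteq> 0" and A: "?A \<subseteq> {x. u \<bullet> x = b}"
      using empty_interior_subset_hyperplane[OF convex_ball_centres[OF assms(2) r0]] by blast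
    have slab: "b - r * norm u \<le> u \<bullet> z \<and> u \<bullet> z \<le> b + r * norm u" if z: "z \<in> ?K" for z
    proof -
      obtain x where x: "x \<in> ?A" "z \<in> cball x r" using z by (auto simp: rounded_body_eq)
      then have "u \<bullet> x = b" using A by blast
      then show ?thesis using cball_inner_bounds(3)[OF u r0 x(2)] by (simp add: abs_le_iff)
    qed
    show ?thesis
    proof (rule sup_min_division_le[OF cpt assms(3) balls])
      fix K1 K2 assume "two_division ?K K1 K2"
      note piece = two_division_compact[OF this cpt]
      have "min_width K1 \<le> ((b + r * norm u) - (b - r * norm u)) / norm u"
        using piece slab u by (intro min_width_le) auto
      then show "min (min_width K1) (min_width K2) \<le> 2 * r" using u by simp
    qed
  qed
qed

section \<open>The characterisation\<close>

theorem theorem4p16: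
  fixes C :: "'a::euclidean_space set"
  assumes "DIM('a) \<ge> 2" and "convex_body C"
  shows "sup_min_division inradius C \<in> {0<..inradius C} \<and>
    2 * sup_min_division inradius C =
      sup_min_division min_width (rounded_body C (sup_min_division inradius C)) \<and>
    (\<forall>\<rho>\<in>{0<..inradius C}.
      2 * \<rho> = sup_min_division min_width (rounded_body C \<rho>) \<longrightarrow>
      \<rho> = sup_min_division inradius C)"
proof -
  define r where "r = sup_min_division inradius C"
  have C: "compact C" "convex C" "interior C \<noteq> {}" "C \<noteq> {}"
    using assms(2) interior_subset by (auto simp: convex_body_def)
  have r: "0 < r" "contains_disjoint_balls C r"
    using inradius_division_attained[OF C(1,3)] by (auto simp: r_def)
  have optimal: "\<not> contains_disjoint_balls C s" if "r < s" for s
    using inradius_division_greatest[OF C(1), of s] that r(1) by (auto simp: r_def)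
  have le: "r \<le> inradius C"
    using r inradius_ge[OF C(1)] by (auto simp: contains_disjoint_balls_def)
  have eq: "2 * r = sup_min_division min_width (rounded_body C r)"
    using width_division_rounded_body_optimal[OF C(1,2) r optimal] by simp
  have unique: "\<rho> = r" if \<rho>: "\<rho> \<in> {0<..inradius C}"
    and eq: "2 * \<rho> = sup_min_division min_width (rounded_body C \<rho>)" for \<rho>
  proof (rule ccontr)
    assume "\<rho> \<noteq> r"
    then consider "\<rho> < r" | "r < \<rho>" by linarith
    then show False
    proof cases
      case 1
      then have "2 * r \<le> sup_min_division min_width (rounded_body C \<rho>)"
        using \<rho> r C(1)
        by (intro width_division_ge compact_rounded_body contains_disjoint_balls_rounded_body) auto
      then show False using 1 eq by simp
    next
      case 2
      then have "sup_min_division min_width (rounded_body C \<rho>) < 2 * \<rho>"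
        using \<rho> C optimal by (intro width_division_rounded_body_less) auto
      then show False using eq by simp
    qed
  qed
  have "r \<in> {0<..inradius C}" using r(1) le by simp
  then show ?thesis unfolding r_def[symmetric] using eq unique by blast
qed

end
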